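(* Let $\mathcal{L}$ be a (meet-)semilattice and $\mathcal{G}$ a building set of $\mathcal{L}$ with some chosen linear extension: $\mathcal{G}=\{G_1,\dots,G_t\}$, with $G_i>G_j$ implying $i<j$. Let $\mathrm{Bl}_k\mathcal{L}$ denote the result of the subsequent combinatorial blowups $\mathrm{Bl}_{G_k}(\mathrm{Bl}_{G_{k-1}}(\dots\mathrm{Bl}_{G_1}\mathcal{L}))$. Then the final semilattice $\mathrm{Bl}_t\mathcal{L}$ is equal to the face poset of the simplicial complex $\mathcal{N}(\mathcal{G})$ of nested sets of $\mathcal{G}$.
   Context: All posets are finite. A meet-semilattice is a poset in which any two elements have a greatest lower bound; it has a unique minimal element $\hat 0$, and any subset that has an upper bound has a least upper bound (join), denoted $\vee$. "Semilattice" means meet-semilattice. Building set: a subset $\mathcal{G}$ of $\mathcal{L}$ such that for any $x\in\mathcal{L}$, writing $\max\mathcal{G}_{\le x}=\{x_1,\dots,x_k\}$ for the set of maximal elements of $\{g\in\mathcal{G}: g\le x\}$, there is an isomorphism of posets $\varphi_x:\prod_{j=1}^k[\hat 0,x_j]\to[\hat 0,x]$ with $\varphi_x(\hat 0,\dots,x_j,\dots,\hat 0)=x_j$ for $j=1,\dots,k$. Nested set: a subset $N\subseteq\mathcal{G}$ such that for any set of incomparable elements $x_1,\dots,x_t\in N$ of cardinality at least two the join $x_1\vee\dots\vee x_t$ exists and does not belong to $\mathcal{G}$. The nested sets form an abstract simplicial complex $\mathcal{N}(\mathcal{G})$, whose vertices are the elements of $\mathcal{G}$. Its face poset is the set of its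 faces (the empty face being the minimal element) ordered by inclusion. Combinatorial blowup: for a semilattice $\mathcal{L}$ and $\alpha\in\mathcal{L}$, the poset $\mathrm{Bl}_\alpha\mathcal{L}$ has as elements (1) all $y\in\mathcal{L}$ with $y\not\ge\alpha$, and (2) symbols $[\alpha,y]$ for all $y\in\mathcal{L}$ with $y\not\ge\alpha$ such that the join $y\vee\alpha$ exists in $\mathcal{L}$. The order relations are: $y>z$ in $\mathrm{Bl}_\alpha\mathcal{L}$ if $y>z$ in $\mathcal{L}$; $[\alpha,y]>[\alpha,z]$ if $y>z$ in $\mathcal{L}$; $[\alpha,y]>z$ if $y\ge z$ in $\mathcal{L}$ (in all three cases $y,z\not\ge\alpha$). $\mathrm{Bl}_\alpha\mathcal{L}$ is again a semilattice. In the sequence of blowups, because of the chosen order, $G_i$ is still an element (of type (1)) of $\mathrm{Bl}_{i-1}\mathcal{L}$ when it is blown up.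
   Formalization: The building set is additionally assumed not to contain the minimal element 0̂ (the usual convention); if it did, the last blowup would be at 0̂ and give the empty poset, while the face poset contains the empty nested set. *)

theory Defs
  imports "HOL-Algebra.Lattice" "HOL-Library.FuncSet"
begin

definition interval_poset :: "'a gorder \<Rightarrow> 'a \<Rightarrow> 'a \<Rightarrow> 'a gorder" where
  "interval_poset L a b = L\<lparr>carrier := \<lbrace>a..b\<rbrace>\<^bsub>L\<^esub>\<rparr>"

definition product_poset :: "'i set \<Rightarrow> ('i \<Rightarrow> 'a gorder) \<Rightarrow> ('i \<Rightarrow> 'a) gorder" where
  "product_poset I P =
     \<lparr>carrier = (\<Pi>\<^sub>E i\<in>I. carrier (P i)), eq = (=), le = (\<lambda>u v. \<forall>i\<in>I. u i \<sqsubseteq>\<^bsub>P i\<^esub> v i)\<rparr>"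

definition order_isomorphism :: "'a gorder \<Rightarrow> 'b gorder \<Rightarrow> ('a \<Rightarrow> 'b) \<Rightarrow> bool" where
  "order_isomorphism P Q f \<longleftrightarrow> order_emb P Q f \<and> bij_betw f (carrier P) (carrier Q)"

definition max_below :: "'a gorder \<Rightarrow> 'a set \<Rightarrow> 'a \<Rightarrow> 'a set" where
  "max_below L \<G> x = {g \<in> \<G>. g \<sqsubseteq>\<^bsub>L\<^esub> x \<and> (\<forall>h\<in>\<G>. h \<sqsubseteq>\<^bsub>L\<^esub> x \<and> g \<sqsubseteq>\<^bsub>L\<^esub> h \<longrightarrow> h = g)}"

text \<open>The factors of the product are indexed by the maximal elements themselves.\<close>

definition building_set :: "'a gorder \<Rightarrow> 'a set \<Rightarrow> bool" where
  "building_set L \<G> \<longleftrightarrow> \<G> \<subseteq> carrier L \<and>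
     (\<forall>x\<in>carrier L. \<exists>\<phi>.
        order_isomorphism
          (product_poset (max_below L \<G> x) (interval_poset L \<bottom>\<^bsub>L\<^esub>))
          (interval_poset L \<bottom>\<^bsub>L\<^esub> x) \<phi> \<and>
        (\<forall>g\<in>max_below L \<G> x. \<phi> (\<lambda>h\<in>max_below L \<G> x. if h = g then g else \<bottom>\<^bsub>L\<^esub>) = g))"

definition incomparable :: "'a gorder \<Rightarrow> 'a set \<Rightarrow> bool" where
  "incomparable L X \<longleftrightarrow> (\<forall>x\<in>X. \<forall>y\<in>X. x \<noteq> y \<longrightarrow> \<not> x \<sqsubseteq>\<^bsub>L\<^esub> y)"

definition nested_sets :: "'a gorder \<Rightarrow> 'a set \<Rightarrow> 'a set set" where
  "nested_sets L \<G> = {N. N \<subseteq> \<G> \<and>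
     (\<forall>X\<subseteq>N. incomparable L X \<and> card X \<ge> 2 \<longrightarrow> (\<exists>s. is_lub L s X \<and> s \<notin> \<G>))}"

definition face_poset :: "'a set set \<Rightarrow> 'a set gorder" where
  "face_poset K = \<lparr>carrier = K, eq = (=), le = (\<subseteq>)\<rparr>"

text \<open>
  One type for the elements of all iterated blowups: \<open>Base y\<close> is an element \<open>y\<close> of the
  original poset, \<open>Sym \<alpha> y\<close> is the symbol \<open>[\<alpha>, y]\<close>.
\<close>

datatype 'a blowup_elem = Base 'a | Sym "'a blowup_elem" "'a blowup_elem"

definition base_poset :: "'a gorder \<Rightarrow> 'a blowup_elem gorder" where
  "base_poset L = \<lparr>carrier = Base ` carrier L, eq = (=),
     le = (\<lambda>u v. \<exists>y z. u = Base y \<and> v = Base z \<and> y \<sqsubseteq>\<^bsub>L\<^esub> z)\<rparr>"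

definition not_above :: "'a gorder \<Rightarrow> 'a \<Rightarrow> 'a set" where
  "not_above L \<alpha> = {y \<in> carrier L. \<not> \<alpha> \<sqsubseteq>\<^bsub>L\<^esub> y}"

text \<open>
  The combinatorial blowup of \<open>L\<close> at \<open>\<alpha>\<close>, with the reflexive version of its order. The symbols
  \<open>Sym \<alpha> y\<close> are meant to be new, that is, not elements of \<open>L\<close>; lemma \<open>iterated_blowup_fresh\<close>
  below shows that this is so at every step of the iteration.
\<close>

definition blowup :: "'a blowup_elem \<Rightarrow> 'a blowup_elem gorder \<Rightarrow> 'a blowup_elem gorder" where
  "blowup \<alpha> L =
     \<lparr>carrier = not_above L \<alpha> \<union> {Sym \<alpha> y |y. y \<in> not_above L \<alpha> \<and> (\<exists>s. is_lub L s {y, \<alpha>})},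
      eq = (=),
      le = (\<lambda>u v.
        (u \<in> not_above L \<alpha> \<and> v \<in> not_above L \<alpha> \<and> u \<sqsubseteq>\<^bsub>L\<^esub> v) \<or>
        (\<exists>z\<in>not_above L \<alpha>. \<exists>y\<in>not_above L \<alpha>. u = Sym \<alpha> z \<and> v = Sym \<alpha> y \<and> z \<sqsubseteq>\<^bsub>L\<^esub> y) \<or>
        (\<exists>y\<in>not_above L \<alpha>. u \<in> not_above L \<alpha> \<and> v = Sym \<alpha> y \<and> u \<sqsubseteq>\<^bsub>L\<^esub> y))\<rparr>"

primrec iterated_blowup :: "'a gorder \<Rightarrow> (nat \<Rightarrow> 'a) \<Rightarrow> nat \<Rightarrow> 'a blowup_elem gorder" where
  "iterated_blowup L G 0 = base_poset L"
| "iterated_blowup L G (Suc k) = blowup (Base (G (Suc k))) (iterated_blowup L G k)"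

lemma iterated_blowup_Sym:
  "Sym \<alpha> y \<in> carrier (iterated_blowup L G k) \<Longrightarrow> \<exists>i\<in>{1..k}. \<alpha> = Base (G i)"
proof (induction k)
  case 0
  then show ?case by (auto simp: base_poset_def)
next
  case (Suc k)
  then show ?case by (fastforce simp: blowup_def not_above_def)
qed

lemma iterated_blowup_fresh:
  assumes "inj_on G {1..t}" and "k < t"
  shows "Sym (Base (G (Suc k))) y \<notin> carrier (iterated_blowup L G k)"
proof
  assume "Sym (Base (G (Suc k))) y \<in> carrier (iterated_blowup L G k)"
  then obtain i where i: "i \<in> {1..k}" "G (Suc k) = G i"
    using iterated_blowup_Sym by fastforce
  with assms have "Suc k = i"
    by (auto dest: inj_onD)
  with i(1) show False by simp
qed

definition linear_extension :: "'a gorder \<Rightarrow> 'a set \<Rightarrow> nat \<Rightarrow> (nat \<Rightarrow> 'a) \<Rightarrow> bool" where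
  "linear_extension L \<G> t G \<longleftrightarrow> bij_betw G {1..t} \<G> \<and>
     (\<forall>i\<in>{1..t}. \<forall>j\<in>{1..t}. G j \<sqsubset>\<^bsub>L\<^esub> G i \<longrightarrow> i < j)"

end

theory Submission
  imports Defs
begin

text \<open>
  Write \<open>F(y)\<close> for the set of maximal elements of \<open>\<G>\<close> below \<open>y\<close>. The defining property of a
  building set implies that a subset \<open>N\<close> of \<open>\<G>\<close> is nested iff every antichain \<open>X\<close> in \<open>N\<close> has a
  join \<open>s\<close> with \<open>F(s) = X\<close>. An element of an iterated blowup has the form
  \<open>[\<alpha>\<^sub>1, [\<alpha>\<^sub>2, \<dots>, y]]\<close> and is determined by \<open>S = {\<alpha>\<^sub>1, \<alpha>\<^sub>2, \<dots>}\<close> and \<open>y\<close>. By induction on the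
  number of blowups, the pairs \<open>(S, y)\<close> that occur after blowing up the elements of \<open>U\<close> are those
  with \<open>S \<subseteq> U\<close>, no element of \<open>U\<close> below \<open>y\<close>, and \<open>S \<union> F(y)\<close> nested, ordered componentwise.
  The induction step amounts to the fact that \<open>(S, y)\<close> and \<open>({}, \<alpha>)\<close> have a join iff
  \<open>insert \<alpha> S \<union> F(y)\<close> is nested. When all of \<open>\<G>\<close> is blown up, \<open>y = \<bottom>\<close> and only the nested
  set \<open>S\<close> remains.
\<close>

section \<open>Decoding iterated symbols into pairs\<close>

text \<open>Only elements of the original poset are ever blown up, so in an iterated blowup the
  first argument of \<open>Sym\<close> has the form \<open>Base \<alpha>\<close>, and
  \<open>snd (decode a)\<close> recovers that \<alpha>.\<close>

primrec decode :: "'a blowup_elem \<Rightarrow> 'a set \<times> 'a" where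
  "decode (Base y) = ({}, y)"
| "decode (Sym a b) = (insert (snd (decode a)) (fst (decode b)), snd (decode b))"

lemma decode_eq_Base: "decode u = ({}, y) \<longleftrightarrow> u = Base y"
  by (cases u) auto

lemma iterated_blowup_eq: "eq (iterated_blowup L G k) = (=)"
  by (cases k) (simp_all add: base_poset_def blowup_def)

section \<open>Joins, maximal elements and factors\<close>

text \<open>The bottom is excluded from \<open>\<G>\<close> because blowing it up would leave an
  empty poset, whereas the empty set is always nested.\<close>

locale building_semilattice = lower_semilattice L for L (structure) +
  fixes \<G> :: "'a set"
  assumes finite_carrier: "finite (carrier L)"
    and carrier_nonempty: "carrier L \<noteq> {}"
    and building: "building_set L \<G>"
    and bottom_notin: "\<bottom> \<notin> \<G>"
begin

sublocale weak_partial_order_bottom L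
proof
  show "\<exists>x. least L x (carrier L)"
    using finite_inf_greatest[OF finite_carrier subset_refl carrier_nonempty]
    by (intro exI[of _ "\<Sqinter>carrier L"]) (auto simp: least_def greatest_def Lower_def)
qed

declare le_cong_l [rule del] le_cong_r [rule del] weak_refl [rule del]
  le_antisym [rule del] Upper_elemD [rule del]

abbreviation factors :: "'a \<Rightarrow> 'a set"
  where "factors x \<equiv> max_below L \<G> x"

lemma building_closed: "g \<in> \<G> \<Longrightarrow> g \<in> carrier L"
  using building by (auto simp: building_set_def)

lemma eq_bottomI: "\<lbrakk>x \<in> carrier L; x \<sqsubseteq> \<bottom>\<rbrakk> \<Longrightarrow> x = \<bottom>"
  by (simp add: le_antisym)

lemma factorsD:
  assumes "g \<in> factors z"
  shows "g \<in> \<G>" "g \<in> carrier L" "g \<sqsubseteq> z" "g \<noteq> \<bottom>"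
  using assms building_closed bottom_notin by (auto simp: max_below_def)

lemma factors_incomparable: "incomparable L (factors z)"
  unfolding incomparable_def max_below_def by blast

lemma is_lub_iff:
  "X \<subseteq> carrier L \<Longrightarrow> is_lub L s X \<longleftrightarrow>
     s \<in> carrier L \<and> (\<forall>x\<in>X. x \<sqsubseteq> s) \<and> (\<forall>w\<in>carrier L. (\<forall>x\<in>X. x \<sqsubseteq> w) \<longrightarrow> s \<sqsubseteq> w)"
  by (auto simp: least_def Upper_def subset_iff)

text \<open>The join is the meet of all upper bounds, a finite set that is nonempty because it
  contains \<open>u\<close>.\<close>

lemma lub_exists:
  assumes "X \<subseteq> carrier L" "u \<in> carrier L" "\<forall>x\<in>X. x \<sqsubseteq> u"
  shows "\<exists>s. is_lub L s X \<and> s \<sqsubseteq> u"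
proof -
  let ?U = "Upper L X"
  have u: "u \<in> ?U"
    using assms by (auto simp: Upper_def)
  have g: "greatest L (\<Sqinter>?U) (Lower L ?U)"
    using u finite_subset[OF Upper_closed finite_carrier] by (intro finite_inf_greatest) auto
  have "x \<sqsubseteq> \<Sqinter>?U" if "x \<in> X" for x
    using that assms(1) by (intro greatest_le[OF g] Lower_memI) auto
  then have "is_lub L (\<Sqinter>?U) X"
    using g assms(1) greatest_Lower_below[OF g _ Upper_closed] by (intro least_UpperI) auto
  then show ?thesis
    using least_le[OF _ u] by blast
qed

lemma maximal_above:
  assumes "X \<subseteq> carrier L" "x \<in> X"
  shows "\<exists>m\<in>X. x \<sqsubseteq> m \<and> (\<forall>h\<in>X. m \<sqsubseteq> h \<longrightarrow> h = m)"
  using assms(2)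
proof (induction "card {h \<in> X. x \<sqsubseteq> h}" arbitrary: x rule: less_induct)
  case less
  have fin: "finite {h \<in> X. x \<sqsubseteq> h}"
    using finite_subset[OF assms(1) finite_carrier] by simp
  show ?case
  proof (cases "\<forall>h\<in>X. x \<sqsubseteq> h \<longrightarrow> h = x")
    case True
    then show ?thesis
      using less.prems assms(1) by (intro bexI[of _ x]) auto
  next
    case False
    then obtain h where h: "h \<in> X" "x \<sqsubseteq> h" "h \<noteq> x"
      by blast
    have carr: "x \<in> carrier L" "h \<in> carrier L"
      using h less.prems assms(1) by auto
    \<comment> \<open>Passing from \<open>x\<close> to a strictly larger \<open>h\<close> removes at
      least \<open>x\<close> itself from the set whose size drives the induction.\<close>
    have "{k \<in> X. h \<sqsubseteq> k} \<subset> {k \<in> X. x \<sqsubseteq> k}"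
    proof
      show "{k \<in> X. h \<sqsubseteq> k} \<subseteq> {k \<in> X. x \<sqsubseteq> k}"
        using h carr assms(1) le_trans by blast
      show "{k \<in> X. h \<sqsubseteq> k} \<noteq> {k \<in> X. x \<sqsubseteq> k}"
        using h carr less.prems le_antisym le_refl by blast
    qed
    then have "card {k \<in> X. h \<sqsubseteq> k} < card {k \<in> X. x \<sqsubseteq> k}"
      using fin by (simp add: psubset_card_mono)
    from less.hyps[OF this h(1)] show ?thesis
      using h carr assms(1) le_trans by (meson subsetD)
  qed
qed

lemma below_factor:
  assumes "g \<in> \<G>" "z \<in> carrier L" "g \<sqsubseteq> z"
  shows "\<exists>y\<in>factors z. g \<sqsubseteq> y"
proof -
  have "\<exists>m\<in>{h\<in>\<G>. h \<sqsubseteq> z}. g \<sqsubseteq> m \<and> (\<forall>h\<in>{h\<in>\<G>. h \<sqsubseteq> z}. m \<sqsubseteq> h \<longrightarrow> h = m)"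
    using assms building_closed by (intro maximal_above) auto
  then show ?thesis
    by (auto simp: max_below_def)
qed

lemma factors_eqI:
  assumes "X \<subseteq> \<G>" "incomparable L X" "z \<in> carrier L" "\<And>x. x \<in> X \<Longrightarrow> x \<sqsubseteq> z"
    and "\<And>g. g \<in> \<G> \<Longrightarrow> g \<sqsubseteq> z \<Longrightarrow> \<exists>x\<in>X. g \<sqsubseteq> x"
  shows "factors z = X"
proof
  show "factors z \<subseteq> X"
    using assms unfolding max_below_def by blast
  show "X \<subseteq> factors z"
  proof
    fix x assume x: "x \<in> X"
    have "h = x" if h: "h \<in> \<G>" "h \<sqsubseteq> z" "x \<sqsubseteq> h" for h
    proof -
      obtain x' where x': "x' \<in> X" "h \<sqsubseteq> x'"
        using assms(5) h by blast
      have carr: "x \<in> carrier L" "x' \<in> carrier L" "h \<in> carrier L"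
        using x x' h assms(1) building_closed by auto
      then have "x = x'"
        using x x' h assms(2) le_trans unfolding incomparable_def by metis
      then show ?thesis
        using x' h carr le_antisym by blast
    qed
    then show "x \<in> factors z"
      using x assms by (auto simp: max_below_def)
  qed
qed

section \<open>Coordinates on lower intervals\<close>

text \<open>This puts the isomorphism of the building set into a form fit for computing with
  vectors: intervals starting at the bottom become principal down-sets.\<close>

lemma interval_coordinates:
  assumes "z \<in> carrier L"
  obtains \<phi> where
    "bij_betw \<phi> (\<Pi>\<^sub>E i\<in>factors z. {p \<in> carrier L. p \<sqsubseteq> i}) {p \<in> carrier L. p \<sqsubseteq> z}"
    "\<And>p q. \<lbrakk>p \<in> (\<Pi>\<^sub>E i\<in>factors z. {p \<in> carrier L. p \<sqsubseteq> i});
            q \<in> (\<Pi>\<^sub>E i\<in>factors z. {p \<in> carrier L. p \<sqsubseteq> i})\<rbrakk>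
        \<Longrightarrow> \<phi> p \<sqsubseteq> \<phi> q \<longleftrightarrow> (\<forall>i\<in>factors z. p i \<sqsubseteq> q i)"
    "\<And>g. g \<in> factors z \<Longrightarrow> \<phi> (\<lambda>h\<in>factors z. if h = g then g else \<bottom>) = g"
proof -
  have int: "{x \<in> carrier L. \<bottom> \<sqsubseteq> x \<and> x \<sqsubseteq> y} = {x \<in> carrier L. x \<sqsubseteq> y}" for y
    by auto
  obtain \<phi> where iso: "order_isomorphism (product_poset (factors z) (interval_poset L \<bottom>))
        (interval_poset L \<bottom> z) \<phi>"
    and unit: "\<forall>g\<in>factors z. \<phi> (\<lambda>h\<in>factors z. if h = g then g else \<bottom>) = g"
    using building assms unfolding building_set_def by blast
  show thesis
    using iso unit
    by (intro that[of \<phi>])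
      (simp_all add: order_isomorphism_def order_emb_def product_poset_def interval_poset_def
         at_least_at_most_def int)
qed

text \<open>Every element is the join of its factors. In the coordinates of \<open>z\<close>, the
  meet of \<open>z\<close> and \<open>w\<close> dominates the unit vector of each factor
  \<open>i\<close>, so its entry at \<open>i\<close> is at least \<open>i\<close>, the largest value
  possible there. Hence the meet is \<open>z\<close>.\<close>

lemma le_if_factors_le:
  assumes z: "z \<in> carrier L" and w: "w \<in> carrier L" and le: "\<And>x. x \<in> factors z \<Longrightarrow> x \<sqsubseteq> w"
  shows "z \<sqsubseteq> w"
proof -
  let ?M = "factors z" and ?P = "\<Pi>\<^sub>E i\<in>factors z. {p \<in> carrier L. p \<sqsubseteq> i}"
  obtain \<phi> where bij: "bij_betw \<phi> ?P {p \<in> carrier L. p \<sqsubseteq> z}"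
    and mono: "\<And>p q. \<lbrakk>p \<in> ?P; q \<in> ?P\<rbrakk> \<Longrightarrow> \<phi> p \<sqsubseteq> \<phi> q \<longleftrightarrow> (\<forall>i\<in>?M. p i \<sqsubseteq> q i)"
    and unit: "\<And>g. g \<in> ?M \<Longrightarrow> \<phi> (\<lambda>h\<in>?M. if h = g then g else \<bottom>) = g"
    using interval_coordinates[OF z] by blast
  have surj: "\<exists>q\<in>?P. \<phi> q = p" if "p \<in> carrier L" "p \<sqsubseteq> z" for p
    using bij that unfolding bij_betw_def by (metis (mono_tags, lifting) imageE mem_Collect_eq)
  have m: "z \<sqinter> w \<in> carrier L" "z \<sqinter> w \<sqsubseteq> z" "z \<sqinter> w \<sqsubseteq> w"
    using z w by (simp_all add: meet_left meet_right)
  obtain q where q: "q \<in> ?P" "\<phi> q = z \<sqinter> w"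
    using surj m by blast
  obtain r where r: "r \<in> ?P" "\<phi> r = z"
    using surj z by blast
  have "r i \<sqsubseteq> q i" if i: "i \<in> ?M" for i
  proof -
    let ?e = "\<lambda>h\<in>?M. if h = i then i else \<bottom>"
    have e: "?e \<in> ?P"
      using factorsD(2) by auto
    have "\<phi> ?e \<sqsubseteq> \<phi> q"
      using unit[OF i] q le i factorsD[OF i] z w by (auto intro: meet_le)
    then have "i \<sqsubseteq> q i"
      using mono[OF e q(1)] i by auto
    moreover have "r i \<in> carrier L" "r i \<sqsubseteq> i" "q i \<in> carrier L"
      using r q i by (auto simp: PiE_iff)
    ultimately show ?thesis
      using le_trans factorsD(2)[OF i] by blast
  qed
  then have "z \<sqsubseteq> z \<sqinter> w"
    using mono[OF r(1) q(1)] q r by simp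
  then show ?thesis
    using m z w le_trans by blast
qed

lemma factors_empty: "z \<in> carrier L \<Longrightarrow> factors z = {} \<longleftrightarrow> z = \<bottom>"
  using le_if_factors_le[of z \<bottom>] eq_bottomI factorsD by (metis all_not_in_conv bottom_closed)

text \<open>
  The consequences of \<open>[\<bottom>, z] \<cong> [\<bottom>, \<alpha>] \<times> [\<bottom>, c]\<close> that are needed, where \<open>c\<close> corresponds to the
  vector with entry \<open>\<bottom>\<close> at \<open>\<alpha>\<close> and \<open>h\<close> at every other factor \<open>h\<close>.
\<close>

definition complement :: "'a \<Rightarrow> 'a \<Rightarrow> 'a \<Rightarrow> bool" where
  "complement z \<alpha> c \<longleftrightarrow> c \<in> carrier L \<and> c \<sqsubseteq> z \<and>
     (\<forall>y\<in>factors z. y \<noteq> \<alpha> \<longrightarrow> y \<sqsubseteq> c) \<and>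
     (\<forall>p\<in>carrier L. p \<sqsubseteq> \<alpha> \<and> p \<sqsubseteq> c \<longrightarrow> p = \<bottom>) \<and>
     (\<forall>a\<in>carrier L. \<forall>v\<in>carrier L. \<forall>g\<in>carrier L. \<forall>u.
        a \<sqsubseteq> \<alpha> \<and> v \<sqsubseteq> c \<and> is_lub L u {a, v} \<and> g \<sqsubseteq> u \<longrightarrow>
        (g \<sqsubseteq> \<alpha> \<longrightarrow> g \<sqsubseteq> a) \<and> (g \<sqsubseteq> c \<longrightarrow> g \<sqsubseteq> v))"

lemma complementD:
  assumes "complement z \<alpha> c"
  shows "c \<in> carrier L" "c \<sqsubseteq> z"
    "\<And>y. \<lbrakk>y \<in> factors z; y \<noteq> \<alpha>\<rbrakk> \<Longrightarrow> y \<sqsubseteq> c"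
    "\<And>p. \<lbrakk>p \<in> carrier L; p \<sqsubseteq> \<alpha>; p \<sqsubseteq> c\<rbrakk> \<Longrightarrow> p = \<bottom>"
    "\<And>a v u g. \<lbrakk>a \<in> carrier L; v \<in> carrier L; g \<in> carrier L; a \<sqsubseteq> \<alpha>; v \<sqsubseteq> c;
       is_lub L u {a, v}; g \<sqsubseteq> u; g \<sqsubseteq> \<alpha>\<rbrakk> \<Longrightarrow> g \<sqsubseteq> a"
    "\<And>a v u g. \<lbrakk>a \<in> carrier L; v \<in> carrier L; g \<in> carrier L; a \<sqsubseteq> \<alpha>; v \<sqsubseteq> c;
       is_lub L u {a, v}; g \<sqsubseteq> u; g \<sqsubseteq> c\<rbrakk> \<Longrightarrow> g \<sqsubseteq> v"
  using assms unfolding complement_def by blast+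

lemma complement_exists:
  assumes z: "z \<in> carrier L" and \<alpha>: "\<alpha> \<in> factors z"
  obtains c where "complement z \<alpha> c"
proof -
  let ?M = "factors z" and ?P = "\<Pi>\<^sub>E i\<in>factors z. {p \<in> carrier L. p \<sqsubseteq> i}"
  obtain \<phi> where bij: "bij_betw \<phi> ?P {p \<in> carrier L. p \<sqsubseteq> z}"
    and mono: "\<And>p q. \<lbrakk>p \<in> ?P; q \<in> ?P\<rbrakk> \<Longrightarrow> \<phi> p \<sqsubseteq> \<phi> q \<longleftrightarrow> (\<forall>i\<in>?M. p i \<sqsubseteq> q i)"
    and unit: "\<And>g. g \<in> ?M \<Longrightarrow> \<phi> (\<lambda>h\<in>?M. if h = g then g else \<bottom>) = g"
    using interval_coordinates[OF z] by blast
  have surj: "\<exists>q\<in>?P. \<phi> q = p" if "p \<in> carrier L" "p \<sqsubseteq> z" for p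
    using bij that unfolding bij_betw_def by (metis (mono_tags, lifting) imageE mem_Collect_eq)
  have into: "\<phi> q \<in> carrier L" "\<phi> q \<sqsubseteq> z" if "q \<in> ?P" for q
    using bij that unfolding bij_betw_def by auto
  have coord: "q i \<in> carrier L" "q i \<sqsubseteq> i" if "q \<in> ?P" "i \<in> ?M" for q i
    using that by (auto simp: PiE_iff)
  note M = factorsD[of _ z]
  \<comment> \<open>\<open>e g\<close> is the unit vector of the factor \<open>g\<close>, and
    \<open>d\<close> is the vector of the desired complement. Below \<alpha> lie the vectors that
    vanish away from \<alpha>, below \<open>\<phi> d\<close> those that vanish at \<alpha>.\<close>
  define e where "e g = (\<lambda>h\<in>?M. if h = g then g else \<bottom>)" for g
  define d where "d = (\<lambda>h\<in>?M. if h = \<alpha> then \<bottom> else h)"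
  have e: "e g \<in> ?P" "\<phi> (e g) = g" if "g \<in> ?M" for g
    using M that unit[OF that] by (auto simp: e_def)
  have d: "d \<in> ?P"
    using M by (auto simp: d_def)
  have below_\<alpha>: "\<phi> q \<sqsubseteq> \<alpha> \<longleftrightarrow> (\<forall>i\<in>?M - {\<alpha>}. q i = \<bottom>)" if "q \<in> ?P" for q
    using mono[OF that e(1)[OF \<alpha>]] e(2)[OF \<alpha>] coord[OF that] \<alpha> eq_bottomI
    by (auto simp: e_def)
  have below_d: "\<phi> q \<sqsubseteq> \<phi> d \<longleftrightarrow> q \<alpha> = \<bottom>" if "q \<in> ?P" for q
    using mono[OF that d] coord[OF that] \<alpha> eq_bottomI by (auto simp: d_def)
  \<comment> \<open>The vector \<open>r\<close> glues the entry of \<open>qa\<close> at \<alpha> to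
    the remaining entries of \<open>qv\<close>. It dominates both because each of them vanishes
    where the other is used, so \<open>\<phi> r\<close> bounds their join \<open>u\<close>.\<close>
  have lub_bound: "\<forall>i\<in>?M. qg i \<sqsubseteq> (if i = \<alpha> then qa i else qv i)"
    if q: "qa \<in> ?P" "qv \<in> ?P" "qg \<in> ?P" and le: "\<phi> qa \<sqsubseteq> \<alpha>" "\<phi> qv \<sqsubseteq> \<phi> d"
      and u: "is_lub L u {\<phi> qa, \<phi> qv}" "\<phi> qg \<sqsubseteq> u" for qa qv qg u
  proof -
    define r where "r = (\<lambda>h\<in>?M. if h = \<alpha> then qa h else qv h)"
    have r: "r \<in> ?P"
      using coord q by (auto simp: r_def)
    have "\<phi> qa \<sqsubseteq> \<phi> r" "\<phi> qv \<sqsubseteq> \<phi> r"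
      using mono[OF q(1) r] mono[OF q(2) r] below_\<alpha>[OF q(1)] below_d[OF q(2)] le coord q
      by (auto simp: r_def)
    then have "u \<sqsubseteq> \<phi> r" "u \<in> carrier L"
      using u(1) into[OF q(1)] into[OF q(2)] into[OF r] by (auto simp: is_lub_iff)
    then have "\<phi> qg \<sqsubseteq> \<phi> r"
      using le_trans[OF u(2)] into[OF q(3)] into[OF r] by simp
    then show ?thesis
      using mono[OF q(3) r] by (auto simp: r_def)
  qed
  have z_bound: "p \<sqsubseteq> z" if "p \<in> carrier L" "p \<sqsubseteq> \<alpha> \<or> p \<sqsubseteq> \<phi> d" for p
    using that(2) le_trans[OF _ _ that(1)] into[OF d] z M[OF \<alpha>] by metis
  have lub_coord: "(g \<sqsubseteq> \<alpha> \<longrightarrow> g \<sqsubseteq> a) \<and> (g \<sqsubseteq> \<phi> d \<longrightarrow> g \<sqsubseteq> v)"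
    if h: "a \<in> carrier L" "v \<in> carrier L" "g \<in> carrier L" "a \<sqsubseteq> \<alpha>" "v \<sqsubseteq> \<phi> d"
       "is_lub L u {a, v}" "g \<sqsubseteq> u" for a v u g
  proof -
    have uc: "u \<in> carrier L" "u \<sqsubseteq> z"
      using h z_bound z by (auto simp: is_lub_iff)
    have "g \<sqsubseteq> z"
      using le_trans[OF h(7) uc(2)] h uc z by simp
    then obtain qa qv qg where q: "qa \<in> ?P" "qv \<in> ?P" "qg \<in> ?P" "\<phi> qa = a" "\<phi> qv = v" "\<phi> qg = g"
      using surj[of a] surj[of v] surj[of g] h z_bound by blast
    have *: "\<forall>i\<in>?M. qg i \<sqsubseteq> (if i = \<alpha> then qa i else qv i)"
      by (rule lub_bound[of qa qv qg u]) (use q h in auto)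
    show ?thesis
    proof (intro conjI impI)
      assume "g \<sqsubseteq> \<alpha>"
      then have "qg i = \<bottom>" if "i \<in> ?M" "i \<noteq> \<alpha>" for i
        using below_\<alpha>[OF q(3)] q(6) that by simp
      then have "qg i \<sqsubseteq> qa i" if "i \<in> ?M" for i
        using bspec[OF * that] coord(1)[OF q(1) that] that by (cases "i = \<alpha>") auto
      then show "g \<sqsubseteq> a"
        using mono[OF q(3,1)] q by simp
    next
      assume "g \<sqsubseteq> \<phi> d"
      then have "qg \<alpha> = \<bottom>"
        using below_d[OF q(3)] q(6) by simp
      then have "qg i \<sqsubseteq> qv i" if "i \<in> ?M" for i
        using bspec[OF * that] coord(1)[OF q(2) that] by (cases "i = \<alpha>") auto
      then show "g \<sqsubseteq> v"
        using mono[OF q(3,2)] q by simp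
    qed
  qed
  have y_le: "y \<sqsubseteq> \<phi> d" if "y \<in> ?M" "y \<noteq> \<alpha>" for y
    using below_d[OF e(1)[OF that(1)]] e(2)[OF that(1)] that \<alpha> by (simp add: e_def)
  have disj: "p = \<bottom>" if p: "p \<in> carrier L" "p \<sqsubseteq> \<alpha>" "p \<sqsubseteq> \<phi> d" for p
  proof -
    obtain q where q: "q \<in> ?P" "\<phi> q = p"
      using surj[OF p(1) z_bound[OF p(1)]] p(2) by blast
    obtain b where b: "b \<in> ?P" "\<phi> b = \<bottom>"
      using surj[of \<bottom>] z by auto
    have "q i = \<bottom>" if "i \<in> ?M" for i
      using below_\<alpha>[OF q(1)] below_d[OF q(1)] q(2) p that by (cases "i = \<alpha>") auto
    then have "\<forall>i\<in>?M. q i \<sqsubseteq> b i"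
      using coord(1)[OF b(1)] by simp
    then have "p \<sqsubseteq> \<bottom>"
      using mono[OF q(1) b(1)] q b by simp
    then show ?thesis
      using p eq_bottomI by blast
  qed
  show thesis
  proof (rule that)
    show "complement z \<alpha> (\<phi> d)"
      unfolding complement_def using into[OF d] y_le disj
      by (intro conjI[OF _ conjI[OF _ conjI[OF _ conjI]]] ballI allI impI lub_coord) auto
  qed
qed

section \<open>Nested sets in terms of factors\<close>

text \<open>Given a factor \<alpha> of \<open>z\<close>, split \<open>X\<close> into the members
  below \<alpha>, with join \<open>a\<close>, and the others, with join \<open>v\<close>. Then
  \<open>z\<close> is the join of \<open>a\<close> and \<open>v\<close>, and the product
  decomposition at \<alpha> forces \<open>a\<close> = \<alpha>. As \<alpha> lies in
  \<open>\<G>\<close>, \<open>irr\<close> leaves only one member of \<open>X\<close> below \<alpha>,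
  which must be \<alpha> itself. So all factors belong to \<open>X\<close>, and incomparability
  gives the other inclusion.\<close>

lemma factors_lub_of_antichain:
  assumes X: "X \<subseteq> \<G>" "incomparable L X"
    and z: "is_lub L z X"
    and irr: "\<And>Y s. \<lbrakk>Y \<subseteq> X; 2 \<le> card Y; is_lub L s Y\<rbrakk> \<Longrightarrow> s \<notin> \<G>"
  shows "factors z = X"
proof -
  have Xc: "X \<subseteq> carrier L"
    using X(1) building_closed by blast
  have zc: "z \<in> carrier L" and zX: "\<And>x. x \<in> X \<Longrightarrow> x \<sqsubseteq> z"
    using z Xc by (auto simp: is_lub_iff)
  have sub: "\<alpha> \<in> X" if \<alpha>: "\<alpha> \<in> factors z" for \<alpha>
  proof -
    obtain c where "complement z \<alpha> c"
      using complement_exists[OF zc \<alpha>] .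
    note c = complementD(1-3)[OF this] and split = complementD(5)[OF this]
    note \<alpha>D = factorsD[OF \<alpha>]
    let ?A = "{x \<in> X. x \<sqsubseteq> \<alpha>}" and ?B = "{x \<in> X. \<not> x \<sqsubseteq> \<alpha>}"
    \<comment> \<open>Such an \<open>x\<close> lies below some factor of \<open>z\<close>; that
      factor is not \<alpha>, hence is below the complement \<open>c\<close>.\<close>
    have Bc: "x \<sqsubseteq> c" if x: "x \<in> ?B" for x
    proof -
      obtain y where y: "y \<in> factors z" "x \<sqsubseteq> y"
        using below_factor[OF subsetD[OF X(1)] zc zX] x by blast
      then have "y \<sqsubseteq> c"
        using x c(3) by blast
      then show ?thesis
        using le_trans[OF y(2)] x Xc c(1) factorsD(2)[OF y(1)] by blast
    qed
    have Ac: "?A \<subseteq> carrier L" "?B \<subseteq> carrier L"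
      using Xc by auto
    obtain a where a: "is_lub L a ?A" "a \<sqsubseteq> \<alpha>"
      using lub_exists[OF Ac(1) \<alpha>D(2)] by blast
    obtain v where v: "is_lub L v ?B" "v \<sqsubseteq> c"
      using lub_exists[OF Ac(2) c(1)] Bc by blast
    note al = a(1)[unfolded is_lub_iff[OF Ac(1)]] and vl = v(1)[unfolded is_lub_iff[OF Ac(2)]]
    have ac: "a \<in> carrier L" "v \<in> carrier L"
      using al vl by auto
    have az: "a \<sqsubseteq> z" "v \<sqsubseteq> z"
      using al vl zX zc by auto
    have "is_lub L z {a, v}"
    proof (rule least_UpperI)
      show "x \<sqsubseteq> z" if "x \<in> {a, v}" for x
        using that az by auto
      show "z \<sqsubseteq> y" if "y \<in> Upper L {a, v}" for y
      proof -
        have y: "a \<sqsubseteq> y" "v \<sqsubseteq> y" "y \<in> carrier L"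
          using that ac by (auto simp: Upper_def)
        have "x \<sqsubseteq> y" if x: "x \<in> X" for x
        proof (cases "x \<sqsubseteq> \<alpha>")
          case True
          then have "x \<sqsubseteq> a" using x al by simp
          then show ?thesis using le_trans[OF _ y(1)] x Xc ac y by blast
        next
          case False
          then have "x \<sqsubseteq> v" using x vl by simp
          then show ?thesis using le_trans[OF _ y(2)] x Xc ac y by blast
        qed
        then show ?thesis
          using z y(3) Xc by (auto simp: is_lub_iff)
      qed
    qed (use ac zc in auto)
    then have "\<alpha> \<sqsubseteq> a"
      using split[of a v \<alpha> z] ac a(2) v(2) \<alpha>D by simp
    then have a\<alpha>: "a = \<alpha>"
      using a(2) ac \<alpha>D le_antisym by simp
    have fin: "finite ?A"
      using finite_subset[OF Xc finite_carrier] by simp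
    have "\<not> 2 \<le> card ?A"
      using irr[of ?A a] a(1) a\<alpha> \<alpha>D(1) by auto
    \<comment> \<open>An empty part would have join \<bottom>, but the join is the factor
      \<alpha>.\<close>
    moreover have "?A \<noteq> {}"
    proof
      assume "?A = {}"
      then have "a \<sqsubseteq> \<bottom>"
        using al bottom_closed by blast
      then show False
        using a\<alpha> \<alpha>D(2,4) eq_bottomI by blast
    qed
    ultimately have "card ?A = 1"
      using fin card_gt_0_iff[of ?A] by linarith
    then obtain x where x: "?A = {x}"
      by (auto simp: card_1_singleton_iff)
    then have xX: "x \<in> X" "x \<sqsubseteq> \<alpha>" "x \<in> carrier L"
      using Xc by auto
    have "a \<sqsubseteq> x"
      using al x xX(3) by auto
    then show ?thesis
      using xX a\<alpha> \<alpha>D le_antisym by blast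
  qed
  show ?thesis
  proof
    show "X \<subseteq> factors z"
    proof
      fix x assume x: "x \<in> X"
      obtain y where y: "y \<in> factors z" "x \<sqsubseteq> y"
        using below_factor[OF subsetD[OF X(1) x] zc zX[OF x]] by blast
      then have "x = y"
        using sub[OF y(1)] x X(2) unfolding incomparable_def by blast
      then show "x \<in> factors z"
        using y by simp
    qed
  qed (use sub in blast)
qed

text \<open>Stating the exact factors of the join makes nestedness usable in computations and covers
  antichains of size zero and one as well. From left to right this is
  \<open>factors_lub_of_antichain\<close>. Conversely, an element of \<open>\<G>\<close> is its own
  only factor, so it cannot have two or more factors.\<close>

lemma nested_sets_iff:
  "N \<in> nested_sets L \<G> \<longleftrightarrow> N \<subseteq> \<G> \<and>
     (\<forall>X\<subseteq>N. incomparable L X \<longrightarrow> (\<exists>s. is_lub L s X \<and> factors s = X))"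
  (is "_ \<longleftrightarrow> _ \<and> ?R")
proof (cases "N \<subseteq> \<G>")
  case True
  have Nc: "N \<subseteq> carrier L"
    using True building_closed by blast
  have "N \<in> nested_sets L \<G> \<longleftrightarrow> ?R"
  proof
    assume N: "N \<in> nested_sets L \<G>"
    show ?R
    proof (intro allI impI)
      fix X assume X: "X \<subseteq> N" "incomparable L X"
      have Xc: "X \<subseteq> carrier L"
        using X Nc by blast
      have "\<exists>s. is_lub L s X"
      proof (cases "2 \<le> card X")
        case True
        then show ?thesis
          using N X unfolding nested_sets_def by blast
      next
        case False
        then have "card X = 0 \<or> card X = 1"
          by linarith
        then have "X = {} \<or> (\<exists>x. X = {x})"
          using finite_subset[OF Xc finite_carrier] by (auto simp: card_1_singleton_iff)
        then show ?thesis
        proof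
          assume "X = {}"
          then show ?thesis
            using bottom_least by auto
        next
          assume "\<exists>x. X = {x}"
          then obtain x where "X = {x}" by blast
          then show ?thesis
            using Xc by (intro exI[of _ x]) (simp add: is_lub_iff)
        qed
      qed
      then obtain s where s: "is_lub L s X" by blast
      have "factors s = X"
      proof (rule factors_lub_of_antichain[OF _ X(2) s])
        show "X \<subseteq> \<G>"
          using X True by blast
        fix Y r assume Y: "Y \<subseteq> X" "2 \<le> card Y" "is_lub L r Y"
        have "incomparable L Y"
          using X(2) Y(1) unfolding incomparable_def by blast
        then obtain r' where "is_lub L r' Y" "r' \<notin> \<G>"
          using N X Y unfolding nested_sets_def by blast
        then show "r \<notin> \<G>"
          using least_unique[OF Y(3)] by blast
      qed
      then show "\<exists>s. is_lub L s X \<and> factors s = X"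
        using s by blast
    qed
  next
    assume R: ?R
    have "\<exists>s. is_lub L s X \<and> s \<notin> \<G>" if X: "X \<subseteq> N" "incomparable L X" "2 \<le> card X" for X
    proof -
      obtain s where s: "is_lub L s X" "factors s = X"
        using R X by blast
      have "s \<notin> \<G>"
      proof
        assume sG: "s \<in> \<G>"
        have "factors s = {s}"
          using sG building_closed factorsD(3)
          by (intro factors_eqI) (auto simp: incomparable_def)
        then show False
          using s(2) X(3) by simp
      qed
      then show ?thesis
        using s(1) by blast
    qed
    then show "N \<in> nested_sets L \<G>"
      using True unfolding nested_sets_def by blast
  qed
  then show ?thesis
    using True by blast
qed (simp add: nested_sets_def)

lemma nested_setsD:
  assumes "N \<in> nested_sets L \<G>" "X \<subseteq> N" "incomparable L X"
  obtains s where "is_lub L s X" "factors s = X"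
  using assms by (auto simp: nested_sets_iff)

lemma nested_sets_mono: "N \<in> nested_sets L \<G> \<Longrightarrow> M \<subseteq> N \<Longrightarrow> M \<in> nested_sets L \<G>"
  unfolding nested_sets_def by blast

text \<open>Let \<open>s\<close> be the join of some factors \<open>X\<close> of \<open>y\<close>,
  and let \<open>g\<close> in \<open>\<G>\<close> be below \<open>s\<close>, hence below a factor
  \<alpha> of \<open>y\<close>. If \<alpha> were not in \<open>X\<close>, then \<open>s\<close>
  would lie below the complement of \<alpha>, and \<open>g\<close>, being below both, would be
  \<bottom>.\<close>

lemma factors_nested:
  assumes "y \<in> carrier L"
  shows "factors y \<in> nested_sets L \<G>"
  unfolding nested_sets_iff
proof (intro conjI allI impI)
  show "factors y \<subseteq> \<G>"
    using factorsD(1) by blast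
  fix X assume X: "X \<subseteq> factors y" "incomparable L X"
  have Xc: "X \<subseteq> carrier L"
    using X factorsD(2) by blast
  obtain s where s: "is_lub L s X" "s \<sqsubseteq> y"
    using lub_exists[OF Xc assms] X factorsD(3) by blast
  have sc: "s \<in> carrier L" and sX: "\<And>x. x \<in> X \<Longrightarrow> x \<sqsubseteq> s"
    using s Xc by (auto simp: is_lub_iff)
  have "factors s = X"
  proof (rule factors_eqI[OF _ X(2) sc sX])
    show "X \<subseteq> \<G>"
      using X factorsD(1) by blast
    fix g assume g: "g \<in> \<G>" "g \<sqsubseteq> s"
    have gc: "g \<in> carrier L"
      using g building_closed by blast
    then have "g \<sqsubseteq> y"
      using le_trans[OF g(2) s(2)] sc assms by blast
    then obtain \<alpha> where \<alpha>: "\<alpha> \<in> factors y" "g \<sqsubseteq> \<alpha>"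
      using below_factor[OF g(1) assms] by blast
    obtain c where "complement y \<alpha> c"
      using complement_exists[OF assms \<alpha>(1)] .
    note c = complementD(1,3,4)[OF this]
    have "\<alpha> \<in> X"
    proof (rule ccontr)
      assume "\<alpha> \<notin> X"
      then have "\<forall>x\<in>X. x \<sqsubseteq> c"
        using X c(2) by blast
      then have "s \<sqsubseteq> c"
        using s(1) Xc c(1) by (simp add: is_lub_iff)
      then have "g \<sqsubseteq> c"
        using le_trans[OF g(2)] gc sc c(1) by blast
      then have "g = \<bottom>"
        using c(3) gc \<alpha>(2) by blast
      then show False
        using g(1) bottom_notin by blast
    qed
    then show "\<exists>x\<in>X. g \<sqsubseteq> x"
      using \<alpha>(2) by blast
  qed
  then show "\<exists>s. is_lub L s X \<and> factors s = X"
    using s(1) by blast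
qed

text \<open>By \<open>X\<close>, the element \<open>v\<close> lies below the complement
  \<open>c\<close> of \<alpha> in \<open>z\<close>. An element of \<open>\<G>\<close> below
  \<open>u\<close> lies below a factor of \<open>z\<close>: either below \<alpha>, or below
  \<open>c\<close> and then, by the product decomposition, below \<open>v\<close>.\<close>

lemma factors_join:
  assumes z: "z \<in> carrier L" and \<alpha>: "\<alpha> \<in> factors z"
    and X: "\<And>x. x \<in> factors v \<Longrightarrow> \<exists>y\<in>factors z. y \<noteq> \<alpha> \<and> x \<sqsubseteq> y"
    and v: "v \<in> carrier L" and u: "is_lub L u {\<alpha>, v}"
  shows "factors u = insert \<alpha> (factors v)"
proof -
  obtain c where "complement z \<alpha> c"
    using complement_exists[OF z \<alpha>] .
  note c = complementD(1-3)[OF this] and disj = complementD(4)[OF this]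
    and split = complementD(6)[OF this]
  note \<alpha>D = factorsD[OF \<alpha>]
  have xc: "x \<sqsubseteq> c" if x: "x \<in> factors v" for x
  proof -
    obtain y where y: "y \<in> factors z" "y \<noteq> \<alpha>" "x \<sqsubseteq> y"
      using X[OF x] by blast
    then show ?thesis
      using le_trans[OF y(3) c(3)] factorsD(2)[OF x] factorsD(2)[OF y(1)] c(1) by blast
  qed
  then have vc: "v \<sqsubseteq> c"
    using le_if_factors_le[OF v c(1)] by blast
  have uc: "u \<in> carrier L" "\<alpha> \<sqsubseteq> u" "v \<sqsubseteq> u"
    using u v \<alpha>D by (auto simp: is_lub_iff)
  have uz: "u \<sqsubseteq> z"
    using u v \<alpha>D z le_trans[OF vc c(2)] c(1) by (auto simp: is_lub_iff)
  show ?thesis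
  proof (rule factors_eqI)
    show "insert \<alpha> (factors v) \<subseteq> \<G>"
      using \<alpha>D(1) factorsD(1) by blast
    have "\<not> x \<sqsubseteq> \<alpha>" "\<not> \<alpha> \<sqsubseteq> x" if x: "x \<in> factors v" for x
    proof -
      show "\<not> x \<sqsubseteq> \<alpha>"
        using disj xc[OF x] factorsD[OF x] by blast
      show "\<not> \<alpha> \<sqsubseteq> x"
        using disj[of \<alpha>] le_trans[OF _ xc[OF x]] factorsD(2)[OF x] \<alpha>D c(1) le_refl by blast
    qed
    then show "incomparable L (insert \<alpha> (factors v))"
      using factors_incomparable[of v] unfolding incomparable_def by blast
    show "u \<in> carrier L"
      by fact
    show "x \<sqsubseteq> u" if "x \<in> insert \<alpha> (factors v)" for x
      using that uc le_trans[OF _ uc(3)] v factorsD by blast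
    fix g assume g: "g \<in> \<G>" "g \<sqsubseteq> u"
    have gc: "g \<in> carrier L"
      using g building_closed by blast
    have "g \<sqsubseteq> z"
      using le_trans[OF g(2) uz] gc uc z by blast
    then obtain y where y: "y \<in> factors z" "g \<sqsubseteq> y"
      using below_factor[OF g(1) z] by blast
    show "\<exists>x\<in>insert \<alpha> (factors v). g \<sqsubseteq> x"
    proof (cases "y = \<alpha>")
      case True
      then show ?thesis
        using y by blast
    next
      case False
      then have "g \<sqsubseteq> c"
        using le_trans[OF y(2) c(3)[OF y(1)]] gc factorsD(2)[OF y(1)] c(1) by blast
      then have "g \<sqsubseteq> v"
        using split[of \<alpha> v g u] \<alpha>D v gc vc u g(2) by simp
      then show ?thesis
        using below_factor[OF g(1) v] by blast
    qed
  qed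
qed

section \<open>Joins with the next blown-up element\<close>

text \<open>These sets interpolate between the semilattice, at \<open>U\<close> empty, and the
  nested sets, at \<open>U\<close> = \<open>\<G>\<close>.\<close>

definition partial_faces :: "'a set \<Rightarrow> ('a set \<times> 'a) set" where
  "partial_faces U = {(S, y). S \<subseteq> U \<and> y \<in> carrier L \<and> (\<forall>g\<in>U. \<not> g \<sqsubseteq> y) \<and>
     S \<union> factors y \<in> nested_sets L \<G>}"

text \<open>A common upper bound \<open>(S', w)\<close> of \<open>(S, y)\<close> and
  \<open>({}, \<alpha>)\<close> already forces nestedness. For an antichain \<open>X\<close>
  containing \<alpha>, the rest of \<open>X\<close> has a join \<open>v\<close> because
  \<open>(S, y)\<close> is a partial face. The nested set of \<open>(S', w)\<close> then supplies a
  \<open>z\<close> in which \<alpha> splits off from \<open>v\<close>.\<close>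

lemma insert_nested_if_bounded:
  assumes \<alpha>: "\<alpha> \<in> \<G>" "\<And>g. g \<in> \<G> \<Longrightarrow> \<alpha> \<sqsubseteq> g \<Longrightarrow> g = \<alpha> \<or> g \<in> U"
    and Sy: "(S, y) \<in> partial_faces U"
    and S'w: "(S', w) \<in> partial_faces U" and le: "S \<subseteq> S'" "y \<sqsubseteq> w" "\<alpha> \<sqsubseteq> w"
  shows "insert \<alpha> S \<union> factors y \<in> nested_sets L \<G>"
proof -
  have \<alpha>c: "\<alpha> \<in> carrier L"
    using \<alpha>(1) building_closed by blast
  have y: "y \<in> carrier L" and N: "S \<union> factors y \<in> nested_sets L \<G>"
    using Sy by (auto simp: partial_faces_def)
  have w: "w \<in> carrier L" and wU: "\<And>g. g \<in> U \<Longrightarrow> \<not> g \<sqsubseteq> w"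
    and N': "S' \<union> factors w \<in> nested_sets L \<G>"
    using S'w by (auto simp: partial_faces_def)
  have NG: "S \<union> factors y \<subseteq> \<G>" "S' \<union> factors w \<subseteq> \<G>"
    using N N' by (auto simp: nested_sets_iff)
  \<comment> \<open>Every element of \<open>\<G>\<close> strictly above \<alpha> belongs to
    \<open>U\<close>, so none of them is below \<open>w\<close>.\<close>
  have \<alpha>w: "\<alpha> \<in> factors w"
    using \<alpha> le(3) wU unfolding max_below_def by blast
  show ?thesis
    unfolding nested_sets_iff
  proof (intro conjI allI impI)
    show "insert \<alpha> S \<union> factors y \<subseteq> \<G>"
      using NG \<alpha>(1) by blast
    fix X assume X: "X \<subseteq> insert \<alpha> S \<union> factors y" "incomparable L X"
    have Xc: "X \<subseteq> carrier L"
      using X(1) NG \<alpha>c building_closed by blast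
    show "\<exists>s. is_lub L s X \<and> factors s = X"
    proof (cases "\<alpha> \<in> X")
      case False
      then have "X \<subseteq> S \<union> factors y"
        using X(1) by blast
      then show ?thesis
        using nested_setsD[OF N _ X(2)] by blast
    next
      case True
      let ?X' = "X - {\<alpha>}"
      have X'N: "?X' \<subseteq> S \<union> factors y" "incomparable L ?X'" "?X' \<subseteq> carrier L"
        using X Xc unfolding incomparable_def by auto
      obtain v where v: "is_lub L v ?X'" "factors v = ?X'"
        using nested_setsD[OF N X'N(1,2)] by blast
      have vc: "v \<in> carrier L"
        using v(1) by blast
      have nle: "\<not> x \<sqsubseteq> \<alpha>" "\<not> \<alpha> \<sqsubseteq> x" if "x \<in> ?X'" for x
        using that X(2) True unfolding incomparable_def by auto
      \<comment> \<open>The maximal elements of \<open>Y0\<close> form an antichain in \<open>S' \<union> factors w\<close>. Their join \<open>z\<close> bounds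
        \<open>X\<close>, and since \<open>\<alpha>\<close> is a factor of \<open>z\<close>, it splits off from the join of \<open>X\<close>.\<close>
      define Y0 where "Y0 = insert \<alpha> ((X \<inter> S) \<union> {b \<in> factors w. b \<noteq> \<alpha>})"
      define Y where "Y = {m \<in> Y0. \<forall>h\<in>Y0. m \<sqsubseteq> h \<longrightarrow> h = m}"
      have Y0S: "Y0 \<subseteq> S' \<union> factors w"
        using \<alpha>w le(1) by (auto simp: Y0_def)
      then have Y0c: "Y0 \<subseteq> carrier L"
        using NG(2) building_closed by blast
      have Y: "Y \<subseteq> S' \<union> factors w" "incomparable L Y"
        using Y0S unfolding Y_def incomparable_def by auto
      then obtain z where z: "is_lub L z Y" "factors z = Y"
        using nested_setsD[OF N'] by blast
      have zc: "z \<in> carrier L"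
        using z(1) by blast
      have top: "\<exists>m\<in>Y. x \<sqsubseteq> m" if "x \<in> Y0" for x
        using maximal_above[OF Y0c that] unfolding Y_def by blast
      \<comment> \<open>Nothing in \<open>Y0\<close> exceeds \<alpha>: its other elements lie in the
        antichain \<open>X\<close> or in the antichain \<open>factors w\<close>, and both of these
        contain \<alpha>.\<close>
      have \<alpha>max: "h = \<alpha>" if h: "h \<in> Y0" "\<alpha> \<sqsubseteq> h" for h
      proof (rule ccontr)
        assume "h \<noteq> \<alpha>"
        then have "h \<in> ?X' \<or> h \<in> factors w"
          using h(1) by (auto simp: Y0_def)
        then show False
        proof
          assume "h \<in> ?X'"
          then show False
            using nle(2) h(2) by blast
        next
          assume "h \<in> factors w"
          then have "\<not> \<alpha> \<sqsubseteq> h"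
            using factors_incomparable[of w] \<alpha>w \<open>h \<noteq> \<alpha>\<close> unfolding incomparable_def by simp
          then show False
            using h(2) by simp
        qed
      qed
      then have \<alpha>Y: "\<alpha> \<in> factors z"
        unfolding z(2) Y_def Y0_def by blast
      have dom: "\<exists>m\<in>factors z. m \<noteq> \<alpha> \<and> x \<sqsubseteq> m" if x: "x \<in> factors v" for x
      proof -
        have x': "x \<in> ?X'" "x \<in> carrier L"
          using x v(2) Xc by auto
        \<comment> \<open>An \<open>x\<close> from \<open>S\<close> is itself in \<open>Y0\<close>.
          Otherwise \<open>x\<close> is a factor of \<open>y\<close>, hence below a factor
          \<open>b\<close> of \<open>w\<close>, and \<open>b\<close> is not \<alpha> because
          \<open>x\<close> is not below \<alpha>.\<close>
        obtain h where h: "h \<in> Y0" "x \<sqsubseteq> h"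
        proof (cases "x \<in> S")
          case True
          then show thesis
            using that[of x] x' by (auto simp: Y0_def)
        next
          case False
          then have "x \<in> factors y"
            using x' X by blast
          note xy = factorsD[OF this]
          have "x \<sqsubseteq> w"
            using le_trans[OF xy(3) le(2)] x' y w by blast
          then obtain b where b: "b \<in> factors w" "x \<sqsubseteq> b"
            using below_factor[OF xy(1) w] by blast
          then have "b \<noteq> \<alpha>"
            using nle(1)[OF x'(1)] by blast
          then show thesis
            using that[of b] b by (auto simp: Y0_def)
        qed
        obtain m where m: "m \<in> Y" "h \<sqsubseteq> m"
          using top h by blast
        have mc: "m \<in> carrier L" "h \<in> carrier L"
          using m(1) h(1) Y0c unfolding Y_def by auto
        have "x \<sqsubseteq> m"
          using le_trans[OF h(2) m(2)] x'(2) mc by blast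
        moreover have "m \<noteq> \<alpha>"
          using \<open>x \<sqsubseteq> m\<close> nle(1)[OF x'(1)] by blast
        ultimately show ?thesis
          using m(1) z(2) by blast
      qed
      have "x \<sqsubseteq> z" if x: "x \<in> factors v" for x
      proof -
        obtain m where m: "m \<in> factors z" "x \<sqsubseteq> m"
          using dom x by blast
        then show ?thesis
          using le_trans[OF m(2)] factorsD[OF m(1)] factorsD(2)[OF x] zc by blast
      qed
      then have vz: "v \<sqsubseteq> z"
        using le_if_factors_le[OF vc zc] by blast
      obtain u where u: "is_lub L u {\<alpha>, v}"
        using lub_exists[of "{\<alpha>, v}" z] \<alpha>c vc zc vz factorsD(3)[OF \<alpha>Y] by blast
      have "factors u = insert \<alpha> (factors v)"
        by (rule factors_join[OF zc \<alpha>Y dom vc u])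
      then have Fu: "factors u = X"
        using v(2) True by (simp add: insert_absorb)
      have uc: "u \<in> carrier L"
        using u by blast
      have "is_lub L u X"
        using uc Fu factorsD(3) le_if_factors_le[OF uc] by (subst is_lub_iff[OF Xc]) blast
      then show ?thesis
        using Fu by blast
    qed
  qed
qed

text \<open>The join of \<open>y\<close> and \<alpha> should have as factors \<alpha> and those
  factors of \<open>y\<close> that \<alpha> does not absorb. This set \<open>X\<close> is an
  antichain because \<alpha> is not below \<open>y\<close>, so nestedness provides its join
  \<open>w\<close>. The component \<open>S\<close> stays unchanged.\<close>

lemma join_if_insert_nested:
  assumes \<alpha>: "\<alpha> \<in> \<G>" "\<And>g. g \<in> U \<Longrightarrow> \<not> g \<sqsubseteq> \<alpha>" and U: "U \<subseteq> \<G>"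
    and Sy: "(S, y) \<in> partial_faces U" and n\<alpha>: "\<not> \<alpha> \<sqsubseteq> y"
    and N: "insert \<alpha> S \<union> factors y \<in> nested_sets L \<G>"
  obtains w where "(S, w) \<in> partial_faces U" "is_lub L w {y, \<alpha>}"
proof -
  have \<alpha>c: "\<alpha> \<in> carrier L"
    using \<alpha>(1) building_closed by blast
  have S: "S \<subseteq> U" and y: "y \<in> carrier L" and yU: "\<And>g. g \<in> U \<Longrightarrow> \<not> g \<sqsubseteq> y"
    using Sy by (auto simp: partial_faces_def)
  define X where "X = insert \<alpha> {f \<in> factors y. \<not> f \<sqsubseteq> \<alpha>}"
  have "\<not> \<alpha> \<sqsubseteq> f" if f: "f \<in> factors y" for f
    using le_trans[OF _ factorsD(3)[OF f]] n\<alpha> \<alpha>c y factorsD(2)[OF f] by blast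
  then have X: "X \<subseteq> insert \<alpha> S \<union> factors y" "incomparable L X"
    using factors_incomparable[of y] unfolding X_def incomparable_def by auto
  have Xc: "X \<subseteq> carrier L"
    using \<alpha>c factorsD(2) unfolding X_def by blast
  obtain w where w: "is_lub L w X" "factors w = X"
    using nested_setsD[OF N X] by blast
  note wl = w(1)[unfolded is_lub_iff[OF Xc]]
  have wc: "w \<in> carrier L"
    using w(1) by blast
  have \<alpha>w: "\<alpha> \<sqsubseteq> w"
    using wl by (auto simp: X_def)
  have "f \<sqsubseteq> w" if f: "f \<in> factors y" for f
  proof (cases "f \<sqsubseteq> \<alpha>")
    case True
    then show ?thesis
      using le_trans[OF True \<alpha>w] factorsD(2)[OF f] \<alpha>c wc by blast
  next
    case False
    then show ?thesis
      using wl f by (auto simp: X_def)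
  qed
  then have yw: "y \<sqsubseteq> w"
    using le_if_factors_le[OF y wc] by blast
  have "w \<sqsubseteq> w'" if w': "w' \<in> carrier L" "y \<sqsubseteq> w'" "\<alpha> \<sqsubseteq> w'" for w'
  proof -
    have "f \<sqsubseteq> w'" if f: "f \<in> factors y" for f
      using le_trans[OF factorsD(3)[OF f] w'(2)] factorsD(2)[OF f] y w'(1) by blast
    then show ?thesis
      using wl w' by (auto simp: X_def)
  qed
  then have lub: "is_lub L w {y, \<alpha>}"
    using wc yw \<alpha>w y \<alpha>c by (auto simp: is_lub_iff)
  \<comment> \<open>Such a \<open>g\<close> would lie below a factor of \<open>w\<close>, that is,
    below \<alpha> or below a factor of \<open>y\<close>; both are excluded.\<close>
  have "\<not> g \<sqsubseteq> w" if g: "g \<in> U" for g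
  proof
    assume "g \<sqsubseteq> w"
    then obtain x where x: "x \<in> factors w" "g \<sqsubseteq> x"
      using below_factor[of g w] g U wc by blast
    then have "x \<in> factors y"
      using w(2) \<alpha>(2)[OF g] by (auto simp: X_def)
    then have "g \<sqsubseteq> y"
      using le_trans[OF x(2) factorsD(3)] building_closed g U y factorsD(2)[OF x(1)] by blast
    then show False
      using yU g by blast
  qed
  moreover have "S \<union> factors w \<in> nested_sets L \<G>"
    using nested_sets_mono[OF N, of "S \<union> factors w"] w(2) X(1) by blast
  ultimately have "(S, w) \<in> partial_faces U"
    using S wc by (auto simp: partial_faces_def)
  then show thesis
    using that lub by blast
qed

section \<open>Blowups as posets of partial faces\<close>

definition le_decoded :: "'a blowup_elem \<Rightarrow> 'a blowup_elem \<Rightarrow> bool" where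
  "le_decoded u v \<longleftrightarrow> fst (decode u) \<subseteq> fst (decode v) \<and> snd (decode u) \<sqsubseteq> snd (decode v)"

definition represents :: "'a blowup_elem gorder \<Rightarrow> 'a set \<Rightarrow> bool" where
  "represents B U \<longleftrightarrow> bij_betw decode (carrier B) (partial_faces U) \<and>
     (\<forall>u\<in>carrier B. \<forall>v\<in>carrier B. u \<sqsubseteq>\<^bsub>B\<^esub> v \<longleftrightarrow> le_decoded u v)"

lemma represents_base: "represents (base_poset L) {}"
proof -
  have "bij_betw decode (Base ` carrier L) ({{}} \<times> carrier L)"
    by (intro bij_betw_byWitness[where f' = "\<lambda>p. Base (snd p)"]) auto
  moreover have "partial_faces {} = {{}} \<times> carrier L"
    using factors_nested by (auto simp: partial_faces_def)
  ultimately show ?thesis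
    by (auto simp: represents_def base_poset_def le_decoded_def)
qed

text \<open>Old elements not above \<alpha> account for the pairs whose first component omits
  \<alpha>, the new symbols for those whose first component contains it. A symbol exists when a join
  with \<alpha> does, which by the two preceding criteria means that adding \<alpha> keeps the set
  nested.\<close>

lemma represents_blowup:
  assumes B: "represents B U" and U: "U \<subseteq> \<G>" and \<alpha>: "\<alpha> \<in> \<G>"
    and above: "\<And>g. g \<in> \<G> \<Longrightarrow> \<alpha> \<sqsubseteq> g \<Longrightarrow> g = \<alpha> \<or> g \<in> U"
    and below: "\<And>g. g \<in> U \<Longrightarrow> \<not> g \<sqsubseteq> \<alpha>"
  shows "represents (blowup (Base \<alpha>) B) (insert \<alpha> U)"
proof -
  let ?N = "not_above B (Base \<alpha>)" and ?B' = "blowup (Base \<alpha>) B"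
  have bij: "bij_betw decode (carrier B) (partial_faces U)"
    and le: "\<And>u v. \<lbrakk>u \<in> carrier B; v \<in> carrier B\<rbrakk> \<Longrightarrow> u \<sqsubseteq>\<^bsub>B\<^esub> v \<longleftrightarrow> le_decoded u v"
    using B by (auto simp: represents_def)
  have inj: "inj_on decode (carrier B)" and img: "decode ` carrier B = partial_faces U"
    using bij by (auto simp: bij_betw_def)
  have \<alpha>c: "\<alpha> \<in> carrier L" and \<alpha>U: "\<alpha> \<notin> U"
    using \<alpha> building_closed below by auto
  \<comment> \<open>The only element that decodes to this pair is \<open>Base \<alpha>\<close>, so
    \<alpha> has survived the earlier blowups.\<close>
  have "({}, \<alpha>) \<in> partial_faces U"
    using \<alpha>c below factors_nested by (auto simp: partial_faces_def)
  then obtain b where "b \<in> carrier B" "decode b = ({}, \<alpha>)"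
    using img by (metis imageE)
  then have Base: "Base \<alpha> \<in> carrier B"
    by (simp add: decode_eq_Base)
  have N: "?N = {u \<in> carrier B. \<not> \<alpha> \<sqsubseteq> snd (decode u)}"
    using le[OF Base] by (auto simp: not_above_def le_decoded_def)
  have fstU: "fst (decode u) \<subseteq> U" if "u \<in> carrier B" for u
    using img imageI[OF that, of decode] by (cases "decode u") (simp add: partial_faces_def)
  have lub: "(\<exists>s. is_lub B s {u, Base \<alpha>}) \<longleftrightarrow>
      insert \<alpha> (fst (decode u)) \<union> factors (snd (decode u)) \<in> nested_sets L \<G>" (is "?lhs \<longleftrightarrow> ?rhs")
    if u: "u \<in> ?N" for u
  proof -
    have uc: "u \<in> carrier B" and nu: "\<not> \<alpha> \<sqsubseteq> snd (decode u)"
      using u N by auto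
    obtain S y where Sy: "decode u = (S, y)"
      by fastforce
    have pf: "(S, y) \<in> partial_faces U"
      using uc Sy img by (metis imageI)
    have yc: "y \<in> carrier L"
      using pf by (simp add: partial_faces_def)
    show ?thesis
    proof
      \<comment> \<open>Only the upper bound property of \<open>s\<close> is needed in this
        direction.\<close>
      assume ?lhs
      then obtain s where s: "s \<in> carrier B" "u \<sqsubseteq>\<^bsub>B\<^esub> s" "Base \<alpha> \<sqsubseteq>\<^bsub>B\<^esub> s"
        using uc Base by (auto simp: least_def Upper_def)
      obtain S' w where S'w: "decode s = (S', w)"
        by fastforce
      have "(S', w) \<in> partial_faces U"
        using s S'w img by (metis imageI)
      moreover have "S \<subseteq> S'" "y \<sqsubseteq> w" "\<alpha> \<sqsubseteq> w"
        using le[OF uc s(1)] le[OF Base s(1)] s Sy S'w by (auto simp: le_decoded_def)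
      ultimately show ?rhs
        using insert_nested_if_bounded[OF \<alpha> above pf] Sy by simp
    next
      assume ?rhs
      then obtain w where w: "(S, w) \<in> partial_faces U" "is_lub L w {y, \<alpha>}"
        using join_if_insert_nested[OF \<alpha> below U pf] nu Sy by auto
      obtain s where s: "s \<in> carrier B" "decode s = (S, w)"
        using w(1) img by (metis imageE)
      note wl = w(2)[unfolded is_lub_iff[of "{y, \<alpha>}", simplified, OF conjI[OF yc \<alpha>c]]]
      have "is_lub B s {u, Base \<alpha>}"
      proof (rule least_UpperI)
        show "x \<sqsubseteq>\<^bsub>B\<^esub> s" if "x \<in> {u, Base \<alpha>}" for x
          using that le[OF uc s(1)] le[OF Base s(1)] Sy s(2) wl by (auto simp: le_decoded_def)
        show "s \<sqsubseteq>\<^bsub>B\<^esub> x" if "x \<in> Upper B {u, Base \<alpha>}" for x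
        proof -
          have x: "x \<in> carrier B" "u \<sqsubseteq>\<^bsub>B\<^esub> x" "Base \<alpha> \<sqsubseteq>\<^bsub>B\<^esub> x"
            using that uc Base by (auto simp: Upper_def)
          have "decode x \<in> partial_faces U"
            using x(1) img by blast
          then have "snd (decode x) \<in> carrier L"
            by (auto simp: partial_faces_def)
          then show ?thesis
            using le[OF uc x(1)] le[OF Base x(1)] le[OF s(1) x(1)] x Sy s(2) wl
            by (simp add: le_decoded_def)
        qed
      qed (use uc Base s in auto)
      then show ?lhs
        by blast
    qed
  qed
  \<comment> \<open>Membership of \<alpha> in the first component separates the new symbols from the
    old elements. It yields injectivity, freshness of the symbols, and the fact that no symbol lies
    below an old element.\<close>
  have fst\<alpha>: "\<alpha> \<notin> fst (decode u)" if "u \<in> ?N" for u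
    using fstU that \<alpha>U N by blast
  let ?M = "{u \<in> ?N. insert \<alpha> (fst (decode u)) \<union> factors (snd (decode u)) \<in> nested_sets L \<G>}"
  have carr: "carrier ?B' = ?N \<union> Sym (Base \<alpha>) ` ?M"
    using lub by (auto simp: blowup_def)
  have "inj_on decode (carrier ?B')"
  proof (rule inj_onI)
    fix u v assume uv: "u \<in> carrier ?B'" "v \<in> carrier ?B'" "decode u = decode v"
    have decode_Sym: "b = b'"
      if "b \<in> ?N" "b' \<in> ?N" "decode (Sym (Base \<alpha>) b) = decode (Sym (Base \<alpha>) b')" for b b'
    proof -
      have "decode b = decode b'"
        using that fst\<alpha>[of b] fst\<alpha>[of b'] by (auto intro!: prod_eqI)
      then show ?thesis
        using that N inj by (auto dest: inj_onD)
    qed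
    show "u = v"
      using uv unfolding carr
    proof (elim UnE imageE)
      assume "u \<in> ?N" "v \<in> ?N"
      then show ?thesis
        using uv(3) N inj by (auto dest: inj_onD)
    next
      fix b assume "u \<in> ?N" "v = Sym (Base \<alpha>) b"
      then show ?thesis
        using fst\<alpha>[of u] uv(3) by simp
    next
      fix b assume "u = Sym (Base \<alpha>) b" "v \<in> ?N"
      then show ?thesis
        using fst\<alpha>[of v] uv(3)[symmetric] by simp
    next
      fix b b' assume "u = Sym (Base \<alpha>) b" "v = Sym (Base \<alpha>) b'" "b \<in> ?M" "b' \<in> ?M"
      then show ?thesis
        using decode_Sym[of b b'] uv(3) by simp
    qed
  qed
  moreover have "decode ` carrier ?B' = partial_faces (insert \<alpha> U)"
  proof
    show "decode ` carrier ?B' \<subseteq> partial_faces (insert \<alpha> U)"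
    proof
      fix p assume "p \<in> decode ` carrier ?B'"
      then obtain u where u: "u \<in> carrier ?B'" "p = decode u"
        by blast
      have pf: "decode u \<in> partial_faces U" "\<not> \<alpha> \<sqsubseteq> snd (decode u)" if "u \<in> ?N" for u
        using that N img by auto
      show "p \<in> partial_faces (insert \<alpha> U)"
        using u(1) unfolding carr
      proof (elim UnE imageE)
        assume "u \<in> ?N"
        then show ?thesis
          using pf[of u] u(2) by (cases "decode u") (auto simp: partial_faces_def)
      next
        fix b assume b: "u = Sym (Base \<alpha>) b" "b \<in> ?M"
        then show ?thesis
          using pf[of b] u(2) by (cases "decode b") (auto simp: partial_faces_def)
      qed
    qed
    show "partial_faces (insert \<alpha> U) \<subseteq> decode ` carrier ?B'"
    proof
      fix p assume p: "p \<in> partial_faces (insert \<alpha> U)"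
      obtain S y where Sy: "p = (S, y)"
        by fastforce
      have y: "S \<subseteq> insert \<alpha> U" "y \<in> carrier L" "\<not> \<alpha> \<sqsubseteq> y" "\<And>g. g \<in> U \<Longrightarrow> \<not> g \<sqsubseteq> y"
        "S \<union> factors y \<in> nested_sets L \<G>"
        using p Sy by (auto simp: partial_faces_def)
      \<comment> \<open>Dropping \<alpha> gives a pair present before the blowup. Its preimage
        \<open>u\<close>, or the symbol formed from \<open>u\<close> when \<alpha> is in
        \<open>S\<close>, decodes to the given pair.\<close>
      have "(S - {\<alpha>}) \<union> factors y \<in> nested_sets L \<G>"
        by (rule nested_sets_mono[OF y(5)]) blast
      then have "(S - {\<alpha>}, y) \<in> partial_faces U"
        using y by (auto simp: partial_faces_def)
      then obtain u where u: "u \<in> carrier B" "decode u = (S - {\<alpha>}, y)"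
        using img by (metis imageE)
      then have uN: "u \<in> ?N"
        using N y by simp
      show "p \<in> decode ` carrier ?B'"
      proof (cases "\<alpha> \<in> S")
        case True
        then have "insert \<alpha> (S - {\<alpha>}) = S" "insert \<alpha> (S - {\<alpha>} \<union> factors y) = S \<union> factors y"
          by blast+
        then have "u \<in> ?M" "decode (Sym (Base \<alpha>) u) = p"
          using uN u(2) y(5) Sy by auto
        then show ?thesis
          unfolding carr by (intro rev_image_eqI[of "Sym (Base \<alpha>) u"] UnI2 imageI) simp_all
      next
        case False
        then have "decode u = p"
          using u(2) Sy by simp
        then show ?thesis
          using uN unfolding carr by (intro rev_image_eqI[of u] UnI1) simp_all
      qed
    qed
  qed
  moreover have "u \<sqsubseteq>\<^bsub>?B'\<^esub> v \<longleftrightarrow> le_decoded u v"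
    if uv: "u \<in> carrier ?B'" "v \<in> carrier ?B'" for u v
  proof -
    have new: "Sym (Base \<alpha>) b \<notin> ?N" for b
      using fst\<alpha>[of "Sym (Base \<alpha>) b"] by auto
    have leN: "a \<sqsubseteq>\<^bsub>B\<^esub> b \<longleftrightarrow> le_decoded a b" if "a \<in> ?N" "b \<in> ?N" for a b
      using le that N by blast
    have old_old: ?thesis if "u \<in> ?N" "v \<in> ?N"
      using that new leN by (auto simp: blowup_def)
    have old_new: ?thesis if "u \<in> ?N" "v = Sym (Base \<alpha>) b" "b \<in> ?N" for b
      using that new leN fst\<alpha>[OF that(1)] by (auto simp: blowup_def le_decoded_def)
    have new_old: ?thesis if "v \<in> ?N" "u = Sym (Base \<alpha>) a" "a \<in> ?N" for a
      using that new fst\<alpha>[OF that(1)] by (auto simp: blowup_def le_decoded_def)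
    have new_new: ?thesis if "v = Sym (Base \<alpha>) b" "b \<in> ?N" "u = Sym (Base \<alpha>) a" "a \<in> ?N" for a b
      using that new leN fst\<alpha>[OF that(2)] fst\<alpha>[OF that(4)] by (auto simp: blowup_def le_decoded_def)
    show ?thesis
      using uv old_old old_new new_old new_new unfolding carr by blast
  qed
  ultimately show ?thesis
    by (simp add: represents_def bij_betw_def)
qed

text \<open>The linear extension supplies both order hypotheses of \<open>represents_blowup\<close>:
  elements of \<open>\<G>\<close> strictly above \<open>G (Suc k)\<close> come earlier in the list,
  and those strictly below come later.\<close>

lemma represents_iterated_blowup:
  assumes "linear_extension L \<G> t G" and "k \<le> t"
  shows "represents (iterated_blowup L G k) (G ` {1..k})"
  using assms(2)
proof (induction k)
  case 0
  then show ?case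
    using represents_base by simp
next
  case (Suc k)
  have bij: "bij_betw G {1..t} \<G>"
    and ext: "\<And>i j. \<lbrakk>i \<in> {1..t}; j \<in> {1..t}; G j \<sqsubseteq> G i; G j \<noteq> G i\<rbrakk> \<Longrightarrow> i < j"
    using assms(1) by (auto simp: linear_extension_def lless_eq)
  have G: "G i \<in> \<G>" if "i \<in> {1..t}" for i
    using bij that by (auto simp: bij_betw_def)
  have Gk: "G (Suc k) \<in> \<G>"
    using G Suc.prems by simp
  have "represents (blowup (Base (G (Suc k))) (iterated_blowup L G k)) (insert (G (Suc k)) (G ` {1..k}))"
  proof (rule represents_blowup[OF _ _ Gk])
    show "represents (iterated_blowup L G k) (G ` {1..k})"
      using Suc by simp
    show "G ` {1..k} \<subseteq> \<G>"
      using G Suc.prems by auto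
    show "g = G (Suc k) \<or> g \<in> G ` {1..k}" if g: "g \<in> \<G>" "G (Suc k) \<sqsubseteq> g" for g
    proof -
      obtain i where i: "i \<in> {1..t}" "g = G i"
        using g(1) bij by (auto simp: bij_betw_def)
      have "G (Suc k) \<noteq> G i \<Longrightarrow> i < Suc k"
        using ext[of i "Suc k"] i g Suc.prems by simp
      then show ?thesis
        using i by (metis atLeastAtMost_iff imageI less_Suc_eq_le)
    qed
    show "\<not> g \<sqsubseteq> G (Suc k)" if g: "g \<in> G ` {1..k}" for g
    proof
      assume le: "g \<sqsubseteq> G (Suc k)"
      obtain i where i: "i \<in> {1..k}" "g = G i"
        using g by blast
      then have "G i \<noteq> G (Suc k)"
        using bij Suc.prems inj_onD[of G "{1..t}" i "Suc k"] by (auto simp: bij_betw_def)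
      then show False
        using ext[of "Suc k" i] i le Suc.prems by simp
    qed
  qed
  moreover have "insert (G (Suc k)) (G ` {1..k}) = G ` {1..Suc k}"
    by (simp add: atLeastAtMostSuc_conv)
  ultimately show ?case
    by simp
qed

section \<open>The final blowup\<close>

text \<open>If no element of \<open>\<G>\<close> lies below \<open>y\<close>, then \<open>y\<close>
  has no factors, and only \<bottom> has none.\<close>

lemma partial_faces_all: "partial_faces \<G> = (\<lambda>N. (N, \<bottom>)) ` nested_sets L \<G>"
proof -
  have "(N, y) \<in> partial_faces \<G> \<longleftrightarrow> y = \<bottom> \<and> N \<in> nested_sets L \<G>" for N y
  proof
    assume p: "(N, y) \<in> partial_faces \<G>"
    then have y: "y \<in> carrier L" "\<And>g. g \<in> \<G> \<Longrightarrow> \<not> g \<sqsubseteq> y" "N \<union> factors y \<in> nested_sets L \<G>"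
      by (auto simp: partial_faces_def)
    have "factors y = {}"
      using y(2) factorsD(1,3) by blast
    then show "y = \<bottom> \<and> N \<in> nested_sets L \<G>"
      using factors_empty[OF y(1)] y(3) by simp
  next
    assume N: "y = \<bottom> \<and> N \<in> nested_sets L \<G>"
    have "\<not> g \<sqsubseteq> \<bottom>" if "g \<in> \<G>" for g
      using eq_bottomI[OF building_closed[OF that]] that bottom_notin by blast
    moreover have "factors \<bottom> = {}"
      by (simp add: factors_empty)
    moreover have "N \<subseteq> \<G>"
      using N by (simp add: nested_sets_def)
    ultimately show "(N, y) \<in> partial_faces \<G>"
      using N by (simp add: partial_faces_def)
  qed
  then show ?thesis
    by auto
qed

lemma iterated_blowup_face_poset:
  assumes ext: "linear_extension L \<G> t G"
  shows "order_isomorphism (iterated_blowup L G t) (face_poset (nested_sets L \<G>)) (fst \<circ> decode)"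
proof -
  let ?B = "iterated_blowup L G t" and ?f = "fst \<circ> decode"
  have "G ` {1..t} = \<G>"
    using ext by (simp add: linear_extension_def bij_betw_def)
  then have "represents ?B \<G>"
    using represents_iterated_blowup[OF ext order_refl] by simp
  then have bij: "bij_betw decode (carrier ?B) ((\<lambda>N. (N, \<bottom>)) ` nested_sets L \<G>)"
    and le: "\<And>u v. \<lbrakk>u \<in> carrier ?B; v \<in> carrier ?B\<rbrakk> \<Longrightarrow> u \<sqsubseteq>\<^bsub>?B\<^esub> v \<longleftrightarrow> le_decoded u v"
    by (auto simp: represents_def partial_faces_all)
  have "bij_betw fst ((\<lambda>N. (N, \<bottom>)) ` nested_sets L \<G>) (nested_sets L \<G>)"
    by (intro bij_betw_byWitness[where f' = "\<lambda>N. (N, \<bottom>)"]) auto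
  then have f: "bij_betw ?f (carrier ?B) (nested_sets L \<G>)"
    using bij bij_betw_trans by blast
  have "snd (decode u) = \<bottom>" if "u \<in> carrier ?B" for u
    using bij_betw_apply[OF bij that] by auto
  then have le': "u \<sqsubseteq>\<^bsub>?B\<^esub> v \<longleftrightarrow> ?f u \<subseteq> ?f v" if "u \<in> carrier ?B" "v \<in> carrier ?B" for u v
    using le[OF that] that by (simp add: le_decoded_def)
  \<comment> \<open>The order axioms are pulled back from inclusion; antisymmetry uses that the map
    is injective.\<close>
  have "weak_partial_order ?B"
    using le' inj_onD[OF bij_betw_imp_inj_on[OF f]]
    by unfold_locales (auto simp: iterated_blowup_eq)
  moreover have "weak_partial_order (face_poset (nested_sets L \<G>))"
    by unfold_locales (auto simp: face_poset_def)
  ultimately show ?thesis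
    using f le' by (simp add: order_isomorphism_def order_emb_def face_poset_def)
qed

end

theorem theorem2p3p4:
  fixes L :: "'a gorder" and \<G> :: "'a set" and G :: "nat \<Rightarrow> 'a" and t :: nat
  assumes "lower_semilattice L"
    and "finite (carrier L)"
    and "carrier L \<noteq> {}"
    and "building_set L \<G>"
    and "\<bottom>\<^bsub>L\<^esub> \<notin> \<G>"
    and "linear_extension L \<G> t G"
  shows "\<exists>f. order_isomorphism (iterated_blowup L G t) (face_poset (nested_sets L \<G>)) f"
proof -
  interpret lower_semilattice L
    by fact
  interpret building_semilattice L \<G>
    by unfold_locales fact+
  show ?thesis
    using iterated_blowup_face_poset[OF assms(6)] by blast
qed

end
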